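(* Let $B\in\mathbb{R}_+^{n\times n}$ be a row uniform nonnegative irreducible matrix and let $$\sigma(B)=\{\lambda\in\mathbb{C}: \exists A\in\mathbb{C}^{n\times n},\ \operatorname{Aux}(|A|)=B,\ \det(A-\lambda I)=0\}.$$ Then: (i) If $B$ is unicyclic, then $\sigma(B)=\{s\in\mathbb{C}: |s|=\mu(B)\}$. (ii) If $B$ is multicyclic and $\nu(B)<\mu(B)$, then $\sigma(B)\setminus\{0\}=\{s\in\mathbb{C}: 0<|s|<\mu(B)\}$. (iii) If $B$ is multicyclic and $\nu(B)=\mu(B)$, then $\sigma(B)\setminus\{0\}=\{s\in\mathbb{C}: 0<|s|\le\mu(B)\}$.
   Context: $\mathbb{R}_+$ denotes the nonnegative reals. For a complex matrix $A$, $|A|$ is the matrix of the moduli of its entries. For $A=(a_{ij})\in\mathbb{R}_+^{n\times n}$, the auxiliary matrix $\operatorname{Aux}(A)=(b_{ij})$ is defined by $b_{ij}=\sum_k a_{ik}$ if $a_{ij}\neq0$ and $b_{ij}=0$ if $a_{ij}=0$. A nonnegative matrix is row uniform if, in every row, all nonzero entries are equal. The associated digraph $\mathcal{G}(B)$ has nodes $\{1,\dots,n\}$ and an edge $(i,j)$ of weight $b_{ij}$ exactly when $b_{ij}\neq0$ (loops allowed); $B$ is irreducible if $\mathcal{G}(B)$ is strongly connected. $\mu(B)$ and $\nu(B)$ denote respectively the maximum and the minimum, over all cycles $(i_1,\dots,i_\ell)$ of $\mathcal{G}(B)$, of the cycle geometric mean $(b_{i_1i_2}b_{i_2i_3}\cdots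 b_{i_\ell i_1})^{1/\ell}$ (both are $0$ if there are no cycles). An irreducible matrix $B$ is unicyclic if $\mathcal{G}(B)$ consists of a single Hamiltonian cycle, and multicyclic otherwise. *)

theory Defs
  imports
    "HOL-Analysis.Analysis"
    "Graph_Theory.Pair_Digraph"
    "Graph_Theory.Digraph_Component"
begin

definition nonneg_matrix :: "real ^ 'n ^ 'n \<Rightarrow> bool" where
  "nonneg_matrix B \<longleftrightarrow> (\<forall>i j. 0 \<le> B $ i $ j)"

definition row_uniform :: "real ^ 'n ^ 'n \<Rightarrow> bool" where
  "row_uniform B \<longleftrightarrow> (\<forall>i j k. B $ i $ j \<noteq> 0 \<longrightarrow> B $ i $ k \<noteq> 0 \<longrightarrow> B $ i $ j = B $ i $ k)"

definition moduli :: "complex ^ 'n ^ 'n \<Rightarrow> real ^ 'n ^ 'n" where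
  "moduli A = (\<chi> i j. cmod (A $ i $ j))"

definition Aux :: "real ^ 'n ^ 'n \<Rightarrow> real ^ 'n ^ 'n" where
  "Aux A = (\<chi> i j. if A $ i $ j \<noteq> 0 then (\<Sum>k\<in>UNIV. A $ i $ k) else 0)"

definition assoc_digraph :: "real ^ 'n ^ 'n \<Rightarrow> ('n, 'n \<times> 'n) pre_digraph" where
  "assoc_digraph B = with_proj \<lparr>pverts = UNIV, parcs = {(i, j). B $ i $ j \<noteq> 0}\<rparr>"

text \<open>Strong connectivity uses walks of length \<open>\<ge> 0\<close>, so the \<open>1 \<times> 1\<close> zero matrix is irreducible.\<close>

definition irreducible_matrix :: "real ^ 'n ^ 'n \<Rightarrow> bool" where
  "irreducible_matrix B \<longleftrightarrow> strongly_connected (assoc_digraph B)"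

text \<open>
  The library notion of a cycle is used: a nonempty list of arcs forming a closed walk that
  repeats no vertex. Loops are cycles of length 1.
\<close>

abbreviation cycle_in :: "real ^ 'n ^ 'n \<Rightarrow> ('n \<times> 'n) list \<Rightarrow> bool" where
  "cycle_in B p \<equiv> pre_digraph.cycle (assoc_digraph B) p"

definition cycle_mean :: "real ^ 'n ^ 'n \<Rightarrow> ('n \<times> 'n) list \<Rightarrow> real" where
  "cycle_mean B p = root (length p) (prod_list (map (\<lambda>(i, j). B $ i $ j) p))"

definition cycle_means :: "real ^ 'n ^ 'n \<Rightarrow> real set" where
  "cycle_means B = {cycle_mean B p | p. cycle_in B p}"

text \<open>\<open>Max\<close> and \<open>Min\<close> are only meaningful on finite sets.\<close>

lemma finite_cycle_means: "finite (cycle_means (B :: real ^ 'n::finite ^ 'n))"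
proof -
  interpret fin_digraph "assoc_digraph B"
    by unfold_locales (auto simp: assoc_digraph_def intro: finite_subset[OF subset_UNIV])
  have "{p. cycle_in B p} \<subseteq> {p. set p \<subseteq> arcs (assoc_digraph B) \<and> distinct p}"
    by (auto simp: cycle_conv awalk_def)
  moreover have "finite {p. set p \<subseteq> arcs (assoc_digraph B) \<and> distinct p}"
    using finite_arcs by (rule finite_subset_distinct)
  ultimately have "finite {p. cycle_in B p}" by (rule finite_subset)
  then show ?thesis by (simp add: cycle_means_def)
qed

definition mu :: "real ^ 'n ^ 'n \<Rightarrow> real" where
  "mu B = (if cycle_means B = {} then 0 else Max (cycle_means B))"

definition nu :: "real ^ 'n ^ 'n \<Rightarrow> real" where
  "nu B = (if cycle_means B = {} then 0 else Min (cycle_means B))"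

text \<open>The digraph of \<open>B\<close> has no vertices and arcs other than those of one cycle.\<close>

definition unicyclic :: "real ^ 'n ^ 'n \<Rightarrow> bool" where
  "unicyclic B \<longleftrightarrow> irreducible_matrix B \<and>
     (\<exists>p. cycle_in B p \<and> fst ` set p = verts (assoc_digraph B) \<and> set p = arcs (assoc_digraph B))"

definition multicyclic :: "real ^ 'n ^ 'n \<Rightarrow> bool" where
  "multicyclic B \<longleftrightarrow> irreducible_matrix B \<and> \<not> unicyclic B"

text \<open>\<open>mat c\<close> is \<open>c\<close> times the identity matrix.\<close>

definition aux_spectrum :: "real ^ 'n::finite ^ 'n \<Rightarrow> complex set" where
  "aux_spectrum B = {l. \<exists>A :: complex ^ 'n ^ 'n. Aux (moduli A) = B \<and> det (A - mat l) = 0}"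

end

theory Submission
  imports Defs
begin

text \<open>
  Write \<open>r i\<close> for the common value of the nonzero entries in row \<open>i\<close> of \<open>B\<close>, and let \<open>v > 0\<close>. The
  entries of row \<open>i\<close> of \<open>A\<close> can be chosen so that \<open>(A v) i = s * v i\<close> whenever \<open>v\<close> is constant on the
  successors of \<open>i\<close> and \<open>\<bar>s\<bar> * v i = r i * v j\<close> for them, or \<open>i\<close> has at least two successors and
  \<open>0 < \<bar>s\<bar> * v i < r i * v j\<close> for one of them. So it suffices to find a suitable \<open>v\<close>.

  The bound \<open>\<bar>s\<bar> \<le> \<mu>\<close> comes from a potential \<open>x > 0\<close> with \<open>B i j * x j \<le> \<mu> * x i\<close>: compare the
  eigenvector with \<open>x\<close>. If \<open>\<bar>s\<bar> = \<mu>\<close>, the nodes where \<open>\<bar>v i\<bar> / x i\<close> is maximal are closed under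
  successors, so all these inequalities are equalities and all cycle means agree. Conversely, if
  \<open>0 < \<bar>s\<bar> < \<mu>\<close>, a cycle of maximal mean passes through a node with two successors; a weight
  \<open>v\<close> is propagated backwards from this node along a functional graph containing that cycle, and the
  surplus \<open>\<bar>s\<bar> < \<mu>\<close> accumulates there.
\<close>

section \<open>Walks and cycles as arc lists\<close>

definition edges :: "real ^ 'n ^ 'n \<Rightarrow> ('n \<times> 'n) set" where
  "edges B = {(i, j). B $ i $ j \<noteq> 0}"

lemma pcas_fst_snd: "pcas u p v \<Longrightarrow> map fst p @ [v] = u # map snd p"
  by (induction u p v rule: pcas.induct) auto

lemma pawalk_verts_pcas: "pcas u p v \<Longrightarrow> pawalk_verts u p = u # map snd p"
  by (induction u p v rule: pcas.induct) auto

lemma pcas_append: "pcas u (p @ q) w \<longleftrightarrow> (\<exists>v. pcas u p v \<and> pcas v q w)"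
  by (induction p arbitrary: u) auto

lemma pcas_split:
  assumes "pcas u p w" "v \<in> set (u # map snd p)"
  shows "\<exists>q r. p = q @ r \<and> pcas u q v \<and> pcas v r w"
  using assms
proof (induction p arbitrary: u)
  case (Cons e p)
  show ?case
  proof (cases "v = u")
    case True
    then show ?thesis using Cons.prems by (intro exI[of _ "[]"] exI[of _ "e # p"]) auto
  next
    case False
    then have "pcas (snd e) p w" "v \<in> set (snd e # map snd p)" using Cons.prems by auto
    from Cons.IH[OF this] obtain q r where "p = q @ r" "pcas (snd e) q v" "pcas v r w" by blast
    then show ?thesis using Cons.prems by (intro exI[of _ "e # q"] exI[of _ r]) auto
  qed
qed auto

lemma pcas_last: "pcas u p v \<Longrightarrow> v \<in> set (u # map snd p)"
  by (induction u p v rule: pcas.induct) auto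

text \<open>Serves to shorten paths: when prepending an arc returns to a node already visited, the
  tail from that node is again a simple path.\<close>

lemma pcas_split_distinct:
  assumes "pcas u p w" "v \<in> set (u # map snd p)" "distinct (u # map snd p)"
  shows "\<exists>q r. p = q @ r \<and> pcas u q v \<and> pcas v r w \<and> distinct (v # map snd r)"
proof -
  obtain q r where qr: "p = q @ r" "pcas u q v" "pcas v r w"
    using pcas_split[OF assms(1,2)] by blast
  have "v \<in> set (u # map snd q)" using pcas_last[OF qr(2)] .
  then have "distinct (v # map snd r)" using assms(3) unfolding qr(1) by auto
  then show ?thesis using qr by blast
qed

text \<open>The library demands distinctness of the vertex list without its head; for a closed walk
  from \<open>u\<close> that list is \<open>u # map snd p\<close>, so exactly the end points
  remain.\<close>

lemma cycle_in_iff: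
  "cycle_in B p \<longleftrightarrow> p \<noteq> [] \<and> set p \<subseteq> edges B \<and> distinct (map snd p) \<and> (\<exists>u. pcas u p u)"
proof -
  have "pre_digraph.awalk (assoc_digraph B) u p u \<longleftrightarrow> set p \<subseteq> edges B \<and> pcas u p u" for u
    by (simp add: pre_digraph.awalk_def assoc_digraph_def cas_with_proj_eq edges_def)
  moreover have "pre_digraph.awalk_verts (assoc_digraph B) u p = u # map snd p" if "pcas u p u" for u
    using pawalk_verts_pcas[OF that] by (simp add: assoc_digraph_def awalk_verts_with_proj_eq)
  ultimately show ?thesis
    by (auto simp: pre_digraph.cycle_def)
qed

text \<open>Along a closed walk starts and ends agree as multisets, so distinctness passes from the
  ends to the starts. The arcs of a cycle thus form the graph of a permutation of its nodes.\<close>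

lemma cycle_ends:
  assumes "cycle_in B p"
  shows "inj_on fst (set p)" "inj_on snd (set p)" "fst ` set p = snd ` set p" "distinct p"
proof -
  obtain u where u: "pcas u p u" and d: "distinct (map snd p)"
    using assms by (auto simp: cycle_in_iff)
  have "mset (map fst p @ [u]) = mset (u # map snd p)"
    using pcas_fst_snd[OF u] by simp
  then have m: "mset (map fst p) = mset (map snd p)" by simp
  then have "distinct (map fst p)" using d by (metis mset_eq_imp_distinct_iff)
  moreover have "set (map fst p) = set (map snd p)" using m by (metis mset_eq_setD)
  ultimately show "inj_on fst (set p)" "inj_on snd (set p)" "fst ` set p = snd ` set p" "distinct p"
    using d by (auto simp: distinct_map)
qed

lemma pcas_rtrancl:
  assumes "pcas u p w" "e \<in> set p"
  shows "(u, fst e) \<in> (set p)\<^sup>*" "(snd e, w) \<in> (set p)\<^sup>*"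
proof -
  have *: "(u, w) \<in> (set q)\<^sup>*" if "pcas u q w" for u w :: 'a and q
    using that
  proof (induction q arbitrary: u)
    case (Cons e q)
    have "(u, snd e) \<in> (set (e # q))\<^sup>*" using Cons.prems by (intro r_into_rtrancl) auto
    moreover have "(snd e, w) \<in> (set (e # q))\<^sup>*"
      using Cons by (auto intro: rtrancl_mono[THEN subsetD, of "set q"])
    ultimately show ?case by (rule rtrancl_trans)
  qed auto
  obtain q r where p: "p = q @ e # r" using assms(2) by (meson split_list)
  then obtain "pcas u q (fst e)" "pcas (snd e) r w" using assms(1) by (auto simp: pcas_append)
  then have "(u, fst e) \<in> (set q)\<^sup>*" "(snd e, w) \<in> (set r)\<^sup>*" by (auto dest: *)
  moreover have "(set q)\<^sup>* \<subseteq> (set p)\<^sup>*" "(set r)\<^sup>* \<subseteq> (set p)\<^sup>*" using p by (auto intro!: rtrancl_mono)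
  ultimately show "(u, fst e) \<in> (set p)\<^sup>*" "(snd e, w) \<in> (set p)\<^sup>*" by auto
qed

text \<open>Reachability is stated inside the cycle itself, because the functional graph built later
  may leave a cycle node only along the cycle.\<close>

lemma cycle_strongly_connected:
  assumes "cycle_in B p" "i \<in> fst ` set p" "j \<in> fst ` set p"
  shows "(i, j) \<in> (set p)\<^sup>*"
proof -
  obtain u where u: "pcas u p u" using assms(1) by (auto simp: cycle_in_iff)
  \<comment> \<open>Seeing \<open>i\<close> as an end and \<open>j\<close> as a start, one can walk
    from \<open>i\<close> on to the base point \<open>u\<close> and from there to
    \<open>j\<close>.\<close>
  have "i \<in> snd ` set p" using assms(2) cycle_ends(3)[OF assms(1)] by simp
  then obtain e f where "e \<in> set p" "f \<in> set p" "i = snd e" "j = fst f"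
    using assms(3) by blast
  then show ?thesis using pcas_rtrancl[OF u] by (metis rtrancl_trans)
qed

section \<open>Consequences of irreducibility\<close>

lemma irreducible_rtrancl:
  assumes "irreducible_matrix B"
  shows "(i, j) \<in> (edges B)\<^sup>*"
proof -
  have "reachable (assoc_digraph B) i j"
    using assms by (auto simp: irreducible_matrix_def assoc_digraph_def)
  then have "(i, j) \<in> (arcs_ends (assoc_digraph B))\<^sup>*"
    unfolding reachable_def by (rule rtrancl_on_rtranclI)
  then show ?thesis by (simp add: assoc_digraph_def edges_def)
qed

text \<open>Spreads a property from one node to all: lying on an unbranched cycle, attaining a
  maximal ratio, being a zero of an eigenvector.\<close>

lemma irreducible_closed_UNIV:
  assumes "irreducible_matrix B" "i \<in> S" "\<And>i j. i \<in> S \<Longrightarrow> (i, j) \<in> edges B \<Longrightarrow> j \<in> S"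
  shows "S = UNIV"
proof -
  have "j \<in> S" for j
    using irreducible_rtrancl[OF assms(1), of i j] by (induction rule: rtrancl_induct) (fact assms(2), rule assms(3))
  then show ?thesis by auto
qed

lemma simple_path_exists:
  assumes "(i, j) \<in> E\<^sup>*"
  shows "\<exists>p. set p \<subseteq> E \<and> pcas i p j \<and> distinct (i # map snd p)"
  using assms
proof (induction rule: converse_rtrancl_induct)
  case base
  then show ?case by (intro exI[of _ "[]"]) auto
next
  case (step i k)
  then obtain p where p: "set p \<subseteq> E" "pcas k p j" "distinct (k # map snd p)" by blast
  show ?case
  proof (cases "i \<in> set (k # map snd p)")
    case True
    obtain q r where "p = q @ r" "pcas i r j" "distinct (i # map snd r)"
      using pcas_split_distinct[OF p(2) True p(3)] by blast
    then show ?thesis using p(1) by (intro exI[of _ r]) auto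
  next
    case False
    then show ?thesis using p step by (intro exI[of _ "(i, k) # p"]) auto
  qed
qed

text \<open>A simple path from \<open>j\<close> back to \<open>i\<close> closes the arc to a cycle,
  whose end points are \<open>j # map snd p\<close>.\<close>

lemma edge_on_cycle:
  assumes "irreducible_matrix B" "(i, j) \<in> edges B"
  shows "\<exists>p. cycle_in B p \<and> (i, j) \<in> set p"
proof -
  obtain p where "set p \<subseteq> edges B" "pcas j p i" "distinct (j # map snd p)"
    using simple_path_exists[OF irreducible_rtrancl[OF assms(1)]] by blast
  then have "cycle_in B ((i, j) # p)"
    using assms(2) by (auto simp: cycle_in_iff)
  then show ?thesis by auto
qed

section \<open>Cycle means and potentials\<close>

lemma cycle_mean_le_mu: "cycle_in B p \<Longrightarrow> cycle_mean B p \<le> mu B"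
  and nu_le_cycle_mean: "cycle_in B p \<Longrightarrow> nu B \<le> cycle_mean B p"
  for B :: "real ^ 'n::finite ^ 'n"
  using finite_cycle_means[of B] by (auto simp: mu_def nu_def cycle_means_def intro!: Max_ge Min_le)

lemma mu_attained:
  fixes B :: "real ^ 'n::finite ^ 'n"
  assumes "cycle_in B p"
  obtains q where "cycle_in B q" "cycle_mean B q = mu B"
proof -
  have "mu B \<in> cycle_means B"
    using assms finite_cycle_means[of B] Max_in[of "cycle_means B"]
    by (auto simp: mu_def cycle_means_def)
  then show ?thesis using that by (auto simp: cycle_means_def)
qed

lemma nu_attained:
  fixes B :: "real ^ 'n::finite ^ 'n"
  assumes "cycle_in B p"
  obtains q where "cycle_in B q" "cycle_mean B q = nu B"
proof -
  have "nu B \<in> cycle_means B"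
    using assms finite_cycle_means[of B] Min_in[of "cycle_means B"]
    by (auto simp: nu_def cycle_means_def)
  then show ?thesis using that by (auto simp: cycle_means_def)
qed

text \<open>The arcs of a cycle are distinct, so the list product becomes a product over a set;
  passing to powers avoids roots from here on.\<close>

lemma cycle_mean_power:
  assumes "nonneg_matrix B" "cycle_in B p"
  shows "cycle_mean B p > 0" "cycle_mean B p ^ card (set p) = (\<Prod>(i, j)\<in>set p. B $ i $ j)"
proof -
  have d: "distinct p" and p: "p \<noteq> []" "set p \<subseteq> edges B"
    using cycle_ends[OF assms(2)] assms(2) by (auto simp: cycle_in_iff)
  have pr: "prod_list (map (\<lambda>(i, j). B $ i $ j) p) = (\<Prod>(i, j)\<in>set p. B $ i $ j)"
    using d by (simp add: prod.distinct_set_conv_list)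
  have pos: "(\<Prod>(i, j)\<in>set p. B $ i $ j) > 0"
    using p assms(1) by (intro prod_pos) (force simp: edges_def nonneg_matrix_def less_le)
  show "cycle_mean B p > 0" using pos p by (simp add: cycle_mean_def pr)
  show "cycle_mean B p ^ card (set p) = (\<Prod>(i, j)\<in>set p. B $ i $ j)"
    using pos p d by (simp add: cycle_mean_def pr distinct_card)
qed

lemma cycle_prod_shift:
  fixes v :: "'n::finite \<Rightarrow> real"
  assumes "cycle_in B p"
  shows "(\<Prod>(i, j)\<in>set p. v j) = (\<Prod>(i, j)\<in>set p. v i)"
proof -
  have "(\<Prod>(i, j)\<in>set p. v j) = (\<Prod>j\<in>snd ` set p. v j)"
    using cycle_ends[OF assms] by (subst prod.reindex) (auto simp: case_prod_unfold)
  also have "\<dots> = (\<Prod>j\<in>fst ` set p. v j)" using cycle_ends[OF assms] by simp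
  also have "\<dots> = (\<Prod>(i, j)\<in>set p. v i)"
    using cycle_ends[OF assms] by (subst prod.reindex) (auto simp: case_prod_unfold)
  finally show ?thesis .
qed

text \<open>Invariance under diagonal scaling: every cycle node is the start of one arc and the end
  of one arc, so the factors from \<open>v\<close> cancel around the cycle.\<close>

lemma cycle_mean_scaled:
  assumes "nonneg_matrix B" "cycle_in B p"
  shows "(\<Prod>(i, j)\<in>set p. B $ i $ j * v j) = cycle_mean B p ^ card (set p) * (\<Prod>(i, j)\<in>set p. v i)"
  using cycle_mean_power(2)[OF assms] cycle_prod_shift[OF assms(2), of v]
  by (simp add: case_prod_unfold prod.distrib)

text \<open>Multiply the inequalities around the cycle and cancel the product of the
  \<open>v i\<close>.\<close>

lemma cycle_mean_le:
  assumes B: "nonneg_matrix B" and p: "cycle_in B p" and v: "\<And>i. v i > 0" and m: "m \<ge> 0"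
    and le: "\<And>i j. (i, j) \<in> set p \<Longrightarrow> B $ i $ j * v j \<le> m * v i"
  shows "cycle_mean B p \<le> m"
proof -
  have pos: "(\<Prod>(i, j)\<in>set p. v i) > 0" using v by (intro prod_pos) auto
  have "card (set p) > 0" using p by (auto simp: cycle_in_iff card_gt_0_iff)
  have "cycle_mean B p ^ card (set p) * (\<Prod>(i, j)\<in>set p. v i) = (\<Prod>(i, j)\<in>set p. B $ i $ j * v j)"
    using cycle_mean_scaled[OF B p] by simp
  also have "\<dots> \<le> (\<Prod>(i, j)\<in>set p. m * v i)"
    using le B v by (intro prod_mono) (auto simp: nonneg_matrix_def less_imp_le)
  also have "\<dots> = m ^ card (set p) * (\<Prod>(i, j)\<in>set p. v i)"
    by (simp add: case_prod_unfold prod.distrib)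
  finally have "cycle_mean B p ^ card (set p) \<le> m ^ card (set p)" using pos by simp
  then show ?thesis using \<open>card (set p) > 0\<close> m by (simp add: power_mono_iff cycle_mean_power(1)[OF B p] less_imp_le)
qed

lemma cycle_mean_eq:
  assumes B: "nonneg_matrix B" and p: "cycle_in B p" and v: "\<And>i. v i > 0" and m: "m \<ge> 0"
    and eq: "\<And>i j. (i, j) \<in> set p \<Longrightarrow> B $ i $ j * v j = m * v i"
  shows "cycle_mean B p = m"
proof -
  have pos: "(\<Prod>(i, j)\<in>set p. v i) > 0" using v by (intro prod_pos) auto
  have "card (set p) > 0" using p by (auto simp: cycle_in_iff card_gt_0_iff)
  have "cycle_mean B p ^ card (set p) * (\<Prod>(i, j)\<in>set p. v i) = (\<Prod>(i, j)\<in>set p. B $ i $ j * v j)"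
    using cycle_mean_scaled[OF B p] by simp
  also have "\<dots> = (\<Prod>(i, j)\<in>set p. m * v i)"
    using eq by (intro prod.cong) auto
  also have "\<dots> = m ^ card (set p) * (\<Prod>(i, j)\<in>set p. v i)"
    by (simp add: case_prod_unfold prod.distrib)
  finally have "cycle_mean B p ^ card (set p) = m ^ card (set p)"
    using pos by (metis less_irrefl mult_right_cancel)
  then show ?thesis using \<open>card (set p) > 0\<close> m cycle_mean_power(1)[OF B p]
    by (simp add: power_eq_iff_eq_base less_imp_le)
qed

lemma prod_eq_imp_eq:
  fixes f g :: "'a \<Rightarrow> real"
  assumes "finite S" "\<And>e. e \<in> S \<Longrightarrow> 0 < f e" "\<And>e. e \<in> S \<Longrightarrow> f e \<le> g e"
    and "prod f S = prod g S" "e \<in> S"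
  shows "f e = g e"
proof (rule ccontr)
  assume "f e \<noteq> g e"
  then have lt: "f e < g e" using assms by (simp add: less_le)
  have "prod f (S - {e}) > 0" using assms by (intro prod_pos) auto
  then have "prod f S < g e * prod f (S - {e})"
    using assms(1,5) lt by (simp add: prod.remove)
  also have "\<dots> \<le> g e * prod g (S - {e})"
    using assms lt by (intro mult_left_mono prod_mono) (auto simp: less_imp_le intro: order_trans[of 0 "f e"])
  also have "\<dots> = prod g S" using assms(1,5) by (simp add: prod.remove)
  finally show False using assms(4) by simp
qed

text \<open>Both sides have the same product around the cycle, so none of the positive factors can
  be strictly smaller.\<close>

lemma cycle_tight:
  assumes B: "nonneg_matrix B" and p: "cycle_in B p" and v: "\<And>i. v i > 0"
    and le: "\<And>i j. (i, j) \<in> set p \<Longrightarrow> B $ i $ j * v j \<le> cycle_mean B p * v i"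
    and ij: "(i, j) \<in> set p"
  shows "B $ i $ j * v j = cycle_mean B p * v i"
proof -
  have "(\<Prod>(i, j)\<in>set p. B $ i $ j * v j) = (\<Prod>(i, j)\<in>set p. cycle_mean B p * v i)"
    using cycle_mean_scaled[OF B p, of v] by (simp add: case_prod_unfold prod.distrib)
  moreover have "0 < B $ i $ j" if "(i, j) \<in> set p" for i j
    using that p B by (auto simp: cycle_in_iff edges_def nonneg_matrix_def less_le)
  ultimately show ?thesis
    using prod_eq_imp_eq[of "set p" "\<lambda>(i, j). B $ i $ j * v j" "\<lambda>(i, j). cycle_mean B p * v i" "(i, j)"]
      v le ij by auto
qed

text \<open>Prepending an arc to a simple path either gives a simple path again or splits off a cycle,
  whose weight relative to \<open>m\<close> is at most 1; so simple paths suffice in the maximum.\<close>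

lemma potential_exists:
  fixes B :: "real ^ 'n::finite ^ 'n"
  assumes B: "nonneg_matrix B" and m: "m > 0"
    and means: "\<And>p. cycle_in B p \<Longrightarrow> cycle_mean B p \<le> m"
  obtains x where "\<And>i. x i > 0" "\<And>i j. B $ i $ j * x j \<le> m * x i"
proof -
  \<comment> \<open>\<open>x i\<close> is the largest weight, normalized by \<open>m\<close>, of a
    simple path starting at \<open>i\<close>. The empty path has weight 1, which makes
    \<open>x i\<close> positive.\<close>
  define P where "P i = {p. set p \<subseteq> edges B \<and> (\<exists>w. pcas i p w) \<and> distinct (i # map snd p)}" for i
  define W where "W p = prod_list (map (\<lambda>(i, j). B $ i $ j / m) p)" for p
  define x where "x i = Max (W ` P i)" for i
  have "P i \<subseteq> {p. set p \<subseteq> UNIV \<and> distinct p}" for i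
    by (auto simp: P_def distinct_map)
  then have fin: "finite (P i)" for i
    by (rule finite_subset) (rule finite_subset_distinct, simp)
  have x_ge: "W p \<le> x i" if "p \<in> P i" for p i
    using that fin by (auto simp: x_def)
  have nil: "[] \<in> P i" for i by (auto simp: P_def)
  have x_attained: "\<exists>p\<in>P i. x i = W p" for i
    using Max_in[of "W ` P i"] fin nil by (fastforce simp: x_def)
  have x_pos: "x i > 0" for i using x_ge[OF nil, of i] by (simp add: W_def)
  have W_nonneg: "W p \<ge> 0" for p
    using B m unfolding W_def by (intro prod_list_nonneg) (auto simp: nonneg_matrix_def)
  have W_append: "W (p @ q) = W p * W q" for p q by (simp add: W_def)
  have W_cycle: "W p \<le> 1" if p: "cycle_in B p" for p
  proof -
    have "W p = (\<Prod>(i, j)\<in>set p. B $ i $ j / m)"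
      using cycle_ends(4)[OF p] by (simp add: W_def prod.distinct_set_conv_list)
    also have "\<dots> = cycle_mean B p ^ card (set p) / m ^ card (set p)"
      using cycle_mean_power(2)[OF B p] by (simp add: case_prod_unfold prod_dividef)
    also have "\<dots> \<le> 1"
      using means[OF p] cycle_mean_power(1)[OF B p] m by (simp add: power_mono)
    finally show ?thesis .
  qed
  have "B $ i $ j / m * x j \<le> x i" if e: "(i, j) \<in> edges B" for i j
  proof -
    obtain p where p: "p \<in> P j" "x j = W p" using x_attained by blast
    then obtain w where w: "pcas j p w" and pE: "set p \<subseteq> edges B" and d: "distinct (j # map snd p)"
      by (auto simp: P_def)
    have W: "B $ i $ j / m * x j = W ((i, j) # p)" using p by (simp add: W_def)
    show ?thesis
    proof (cases "i \<in> set (j # map snd p)")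
      case False
      then have "(i, j) # p \<in> P i" using w pE d e by (auto simp: P_def)
      then show ?thesis using x_ge W by simp
    next
      case True
      obtain q r where qr: "p = q @ r" "pcas j q i" "pcas i r w" "distinct (i # map snd r)"
        using pcas_split_distinct[OF w True d] by blast
      have "cycle_in B ((i, j) # q)" using qr pE d e by (auto simp: cycle_in_iff)
      moreover have r: "r \<in> P i" using qr pE by (auto simp: P_def)
      ultimately have "W ((i, j) # q) * W r \<le> 1 * W r"
        using W_cycle W_nonneg by (intro mult_right_mono) auto
      also have "\<dots> \<le> x i" using x_ge[OF r] by simp
      finally show ?thesis using W qr(1) by (simp add: W_append[of "_ # _", simplified])
    qed
  qed
  then have "B $ i $ j * x j \<le> m * x i" for i j
    using m x_pos[of i] by (cases "(i, j) \<in> edges B") (auto simp: edges_def field_simps less_imp_le)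
  then show ?thesis using that x_pos by blast
qed

section \<open>Eigenvectors and branching nodes\<close>

lemma det_eigenvector:
  fixes A :: "complex ^ 'n::finite ^ 'n"
  shows "det (A - mat s) = 0 \<longleftrightarrow> (\<exists>v. v \<noteq> 0 \<and> (\<forall>i. (\<Sum>j\<in>UNIV. A $ i $ j * v $ j) = s * v $ i))"
proof -
  have *: "((A - mat s) *v v) $ i = (\<Sum>j\<in>UNIV. A $ i $ j * v $ j) - s * v $ i" for v :: "complex ^ 'n" and i
  proof -
    have "((A - mat s) *v v) $ i = (\<Sum>j\<in>UNIV. A $ i $ j * v $ j) - (\<Sum>j\<in>UNIV. (if i = j then s else 0) * v $ j)"
      by (simp add: matrix_vector_mult_def mat_def left_diff_distrib sum_subtractf)
    also have "(\<Sum>j\<in>UNIV. (if i = j then s else 0) * v $ j) = s * v $ i"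
      by (simp add: if_distrib[of "\<lambda>x. x * _"] cong: if_cong)
    finally show ?thesis .
  qed
  have "det (A - mat s) = 0 \<longleftrightarrow> (\<exists>v. v \<noteq> 0 \<and> (A - mat s) *v v = 0)"
    using invertible_det_nz[of "A - mat s"] matrix_left_invertible_ker[of "A - mat s"]
    by (auto simp: invertible_left_inverse)
  then show ?thesis by (simp add: vec_eq_iff[of "_ *v _"] *)
qed

text \<open>The nodes of such a cycle are closed under successors, so irreducibility makes it
  Hamiltonian and leaves no further arcs.\<close>

lemma cycle_without_branching:
  assumes irr: "irreducible_matrix B" and p: "cycle_in B p"
    and out: "\<And>i j k. (i, j) \<in> set p \<Longrightarrow> (i, k) \<in> edges B \<Longrightarrow> k = j"
  shows "fst ` set p = UNIV" "set p = edges B"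
proof -
  have "fst (hd p) \<in> fst ` set p" using p by (simp add: cycle_in_iff)
  then obtain i where i: "i \<in> fst ` set p" by blast
  have "k \<in> fst ` set p" if i: "i \<in> fst ` set p" and k: "(i, k) \<in> edges B" for i k
  proof -
    obtain j where "(i, j) \<in> set p" using i by auto
    then have "k \<in> snd ` set p" using out[OF _ k] by force
    then show ?thesis using cycle_ends(3)[OF p] by simp
  qed
  then show U: "fst ` set p = UNIV" using irreducible_closed_UNIV[OF irr i] by blast
  have "edges B \<subseteq> set p"
  proof
    fix e assume e: "e \<in> edges B"
    obtain j where "(fst e, j) \<in> set p" using U by (metis UNIV_I imageE prod.collapse)
    with out[OF this, of "snd e"] e show "e \<in> set p" by auto
  qed
  then show "set p = edges B" using p by (auto simp: cycle_in_iff)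
qed

lemma multicyclic_branching:
  assumes "irreducible_matrix B" "\<not> unicyclic B" "cycle_in B p"
  obtains i j k where "(i, j) \<in> set p" "(i, k) \<in> edges B" "k \<noteq> j"
proof (rule ccontr)
  assume "\<not> thesis"
  then have "fst ` set p = UNIV" "set p = edges B"
    using cycle_without_branching[OF assms(1,3)] that by blast+
  then have "unicyclic B"
    using assms(1,3) by (auto simp: unicyclic_def assoc_digraph_def edges_def)
  then show False using assms(2) by simp
qed

lemma unicyclic_unique_out:
  assumes "unicyclic B" "(i, j) \<in> edges B" "(i, k) \<in> edges B"
  shows "k = j"
proof -
  obtain p where p: "cycle_in B p" "set p = edges B"
    using assms(1) by (auto simp: unicyclic_def assoc_digraph_def edges_def)
  then show ?thesis using cycle_ends(1)[OF p(1)] assms(2,3) by (metis fst_conv inj_onD snd_conv)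
qed

section \<open>Matrices with a prescribed auxiliary matrix\<close>

lemma row_values:
  assumes "nonneg_matrix B" "row_uniform B"
  obtains r where "\<And>i. r i > 0" "\<And>i j. B $ i $ j = (if (i, j) \<in> edges B then r i else 0)"
proof -
  \<comment> \<open>A zero row gets the dummy value 1, so that \<open>r\<close> is positive
    throughout.\<close>
  define r where "r i = (if \<exists>j. B $ i $ j \<noteq> 0 then B $ i $ (SOME j. B $ i $ j \<noteq> 0) else 1)" for i
  have *: "B $ i $ (SOME j. B $ i $ j \<noteq> 0) \<noteq> 0" if "\<exists>j. B $ i $ j \<noteq> 0" for i
    using someI_ex[OF that] .
  have "r i > 0" for i
    using * assms(1) by (auto simp: r_def nonneg_matrix_def less_le)
  moreover have "B $ i $ j = (if (i, j) \<in> edges B then r i else 0)" for i j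
    using * assms(2) unfolding r_def edges_def row_uniform_def by auto
  ultimately show ?thesis using that by blast
qed

text \<open>A nonzero entry makes its row sum of moduli positive, so \<open>Aux\<close> preserves
  the zero pattern and only row sums remain to be compared.\<close>

lemma Aux_moduli_iff:
  fixes B :: "real ^ 'n::finite ^ 'n"
  assumes r: "\<And>i. r i > 0" and B: "\<And>i j. B $ i $ j = (if (i, j) \<in> edges B then r i else 0)"
  shows "Aux (moduli A) = B \<longleftrightarrow>
    (\<forall>i j. A $ i $ j \<noteq> 0 \<longleftrightarrow> (i, j) \<in> edges B) \<and>
    (\<forall>i j. (i, j) \<in> edges B \<longrightarrow> (\<Sum>k\<in>UNIV. cmod (A $ i $ k)) = r i)"
proof -
  have "Aux (moduli A) = B \<longleftrightarrow>
    (\<forall>i j. (if A $ i $ j \<noteq> 0 then \<Sum>k\<in>UNIV. cmod (A $ i $ k) else 0) = (if (i, j) \<in> edges B then r i else 0))"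
    by (simp add: vec_eq_iff Aux_def moduli_def B[symmetric])
  also have "\<dots> \<longleftrightarrow> (\<forall>i j. (A $ i $ j \<noteq> 0 \<longleftrightarrow> (i, j) \<in> edges B) \<and>
    ((i, j) \<in> edges B \<longrightarrow> (\<Sum>k\<in>UNIV. cmod (A $ i $ k)) = r i))"
  proof -
    have "(\<Sum>k\<in>UNIV. cmod (A $ i $ k)) > 0" if "A $ i $ j \<noteq> 0" for i j
      using that by (intro sum_pos2[of _ j]) auto
    then have "(\<Sum>k\<in>UNIV. cmod (A $ i $ k)) \<noteq> 0" if "A $ i $ j \<noteq> 0" for i j
      using that by (metis less_irrefl)
    moreover have "r i \<noteq> 0" for i using r[of i] by simp
    ultimately show ?thesis by (intro all_cong1) auto
  qed
  finally show ?thesis by blast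
qed

section \<open>The upper bound for the spectrum\<close>

text \<open>In the maximum norm weighted by \<open>x\<close>, the matrix \<open>A\<close> has norm
  at most \<open>m\<close>. The bound \<open>m\<close> is kept general because \<open>mu B\<close>
  can be 0.\<close>

lemma spectrum_upper:
  fixes B :: "real ^ 'n::finite ^ 'n"
  assumes B: "nonneg_matrix B" and ru: "row_uniform B" and irr: "irreducible_matrix B"
    and s: "s \<in> aux_spectrum B" and m: "m > 0"
    and x: "\<And>i. x i > 0" and Bx: "\<And>i j. B $ i $ j * x j \<le> m * x i"
  shows "cmod s \<le> m"
    and "cmod s = m \<Longrightarrow> (i, j) \<in> edges B \<Longrightarrow> B $ i $ j * x j = m * x i"
proof -
  obtain r where r: "\<And>i. r i > 0" and Br: "\<And>i j. B $ i $ j = (if (i, j) \<in> edges B then r i else 0)"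
    using row_values[OF B ru] by blast
  obtain A where A: "Aux (moduli A) = B" and det: "det (A - mat s) = 0"
    using s by (auto simp: aux_spectrum_def)
  have A0: "A $ i $ j \<noteq> 0 \<longleftrightarrow> (i, j) \<in> edges B" for i j
    using A Aux_moduli_iff[OF r Br] by blast
  \<comment> \<open>Only an inequality, because of the dummy value of \<open>r\<close> in zero
    rows.\<close>
  have Asum: "(\<Sum>k\<in>UNIV. cmod (A $ i $ k)) \<le> r i" for i
  proof (cases "\<exists>j. (i, j) \<in> edges B")
    case True
    then show ?thesis using A Aux_moduli_iff[OF r Br] by (metis order_refl)
  next
    case False
    then have "A $ i $ j = 0" for j using A0 by blast
    then show ?thesis using r[of i] by simp
  qed
  obtain v where v: "v \<noteq> 0" and Av: "\<And>i. (\<Sum>j\<in>UNIV. A $ i $ j * v $ j) = s * v $ i"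
    using det unfolding det_eigenvector by blast
  define y where "y i = cmod (v $ i) / x i" for i
  define M where "M = Max (range y)"
  have y_le: "y i \<le> M" for i by (simp add: M_def)
  have vy: "cmod (v $ i) = y i * x i" for i using x[of i] by (simp add: y_def)
  obtain k where "v $ k \<noteq> 0" using v by (auto simp: vec_eq_iff)
  then have "y k > 0" using x[of k] by (simp add: y_def)
  then have M: "M > 0" using y_le[of k] by simp
  have term_le: "cmod (A $ i $ j) * cmod (v $ j) \<le> cmod (A $ i $ j) * (m * x i * M / r i)" for i j
  proof (cases "(i, j) \<in> edges B")
    case True
    have "r i * x j * y j \<le> m * x i * M"
      using Bx[of i j] Br[of i j] True y_le[of j] x[of i] x[of j] m M
      by (intro mult_mono[of "r i * x j" "m * x i"]) (auto simp: y_def)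
    then show ?thesis using r[of i] by (intro mult_left_mono) (auto simp: vy field_simps)
  next
    case False
    then have "A $ i $ j = 0" using A0 by blast
    then show ?thesis by simp
  qed
  have lower: "cmod s * (M * x i) \<le> (\<Sum>j\<in>UNIV. cmod (A $ i $ j) * cmod (v $ j))" if "y i = M" for i
  proof -
    have "cmod s * (M * x i) = cmod (\<Sum>j\<in>UNIV. A $ i $ j * v $ j)"
      using that by (simp add: Av norm_mult vy)
    also have "\<dots> \<le> (\<Sum>j\<in>UNIV. cmod (A $ i $ j) * cmod (v $ j))"
      by (rule order_trans[OF norm_sum]) (simp add: norm_mult)
    finally show ?thesis .
  qed
  have upper: "(\<Sum>j\<in>UNIV. cmod (A $ i $ j) * (m * x i * M / r i)) \<le> m * (M * x i)" for i
  proof -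
    have "(\<Sum>j\<in>UNIV. cmod (A $ i $ j) * (m * x i * M / r i)) = (\<Sum>j\<in>UNIV. cmod (A $ i $ j)) * (m * x i * M / r i)"
      by (rule sum_distrib_right[symmetric])
    also have "\<dots> \<le> r i * (m * x i * M / r i)"
      using Asum[of i] m M x[of i] r[of i] by (intro mult_right_mono) auto
    finally show ?thesis using r[of i] by (simp add: mult_ac)
  qed
  have mid: "(\<Sum>j\<in>UNIV. cmod (A $ i $ j) * cmod (v $ j)) \<le> (\<Sum>j\<in>UNIV. cmod (A $ i $ j) * (m * x i * M / r i))" for i
    using term_le by (intro sum_mono)
  have "M \<in> range y" unfolding M_def by (intro Max_in) auto
  then obtain w where w: "y w = M" by auto
  have "cmod s * (M * x w) \<le> m * (M * x w)"
    using lower[OF w] mid[of w] upper[of w] by linarith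
  then show "cmod s \<le> m" using M x[of w] by simp
  assume sm: "cmod s = m"
  have step: "y j = M \<and> r i * x j = m * x i" if i: "y i = M" and e: "(i, j) \<in> edges B" for i j
  proof -
    \<comment> \<open>With \<open>cmod s = m\<close> the chain \<open>lower\<close>,
      \<open>mid\<close>, \<open>upper\<close> collapses, so the termwise bounds are equalities; on
      arcs the nonzero factor from \<open>A\<close> cancels.\<close>
    have "(\<Sum>j\<in>UNIV. cmod (A $ i $ j) * cmod (v $ j)) = (\<Sum>j\<in>UNIV. cmod (A $ i $ j) * (m * x i * M / r i))"
      using lower[OF i] mid[of i] upper[of i] unfolding sm by linarith
    then have "cmod (A $ i $ j) * cmod (v $ j) = cmod (A $ i $ j) * (m * x i * M / r i)"
      by (rule sum_mono_inv) (use term_le in auto)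
    moreover have "cmod (A $ i $ j) \<noteq> 0" using A0 e by simp
    ultimately have "cmod (v $ j) = m * x i * M / r i" by (metis mult_left_cancel)
    then have eq: "r i * x j * y j = m * x i * M" using r[of i] by (simp add: vy field_simps)
    \<comment> \<open>Together with \<open>y j \<le> M\<close>, this forces both factors in
      \<open>eq\<close> to be extremal.\<close>
    have le: "r i * x j \<le> m * x i" using Bx[of i j] Br[of i j] e by simp
    have rx: "r i * x j > 0" using r[of i] x[of j] by simp
    have "m * x i * M \<ge> r i * x j * M" using le M by (simp add: mult_right_mono)
    then have "r i * x j * M \<le> r i * x j * y j" using eq by simp
    then have "y j = M" using rx y_le[of j] by (simp add: mult_le_cancel_left_pos)
    then show ?thesis using eq M by simp
  qed
  then have U: "{i. y i = M} = UNIV"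
    by (intro irreducible_closed_UNIV[OF irr, of w]) (use w in auto)
  assume e: "(i, j) \<in> edges B"
  show "B $ i $ j * x j = m * x i"
    using step[of i j] U e Br[of i j] by auto
qed

section \<open>Matrices with a prescribed eigenvalue\<close>

text \<open>In the second case all weights except that of \<open>f\<close> equal \<open>- r * e\<close>: then the sum is affine in
  \<open>e\<close>, tends to \<open>r * v f\<close> for small \<open>e\<close> and becomes negative when the weight of \<open>f\<close> vanishes.\<close>

lemma row_weights:
  fixes v :: "'n::finite \<Rightarrow> real"
  assumes f: "f \<in> N" and v: "\<And>j. v j > 0" and r: "r > 0" and z: "z > 0"
    and cases: "(\<forall>j\<in>N. v j = v f) \<and> z = r * v f \<or> N \<noteq> {f} \<and> z < r * v f"
  shows "\<exists>a. (\<forall>j. a j \<noteq> 0 \<longleftrightarrow> j \<in> N) \<and> (\<Sum>j\<in>UNIV. \<bar>a j\<bar>) = r \<and> (\<Sum>j\<in>UNIV. a j * v j) = z"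
  using cases
proof (elim disjE conjE)
  assume eq: "\<forall>j\<in>N. v j = v f" and z: "z = r * v f"
  \<comment> \<open>As \<open>v\<close> is constant on \<open>N\<close>, any positive split of
    \<open>r\<close> would do; the uniform one is taken.\<close>
  define a where "a j = (if j \<in> N then r / card N else 0)" for j
  have N: "card N > 0" using f by (auto simp: card_gt_0_iff)
  have "(\<Sum>j\<in>UNIV. \<bar>a j\<bar>) = (\<Sum>j\<in>N. r / card N)"
    by (rule sum.mono_neutral_cong_right) (use r in \<open>auto simp: a_def\<close>)
  moreover have "(\<Sum>j\<in>UNIV. a j * v j) = (\<Sum>j\<in>N. r / card N * v f)"
    by (rule sum.mono_neutral_cong_right) (use eq in \<open>auto simp: a_def\<close>)
  ultimately show ?thesis using N r z by (intro exI[of _ a]) (auto simp: a_def)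
next
  assume "N \<noteq> {f}" and lt: "z < r * v f"
  define K where "K = N - {f}"
  define S where "S = (\<Sum>j\<in>K. v j)"
  define D where "D = card K * v f + S"
  \<comment> \<open>Solves \<open>r * (v f - D * e) = z\<close>, where the left side is the weighted
    sum for the \<open>a\<close> below.\<close>
  define e where "e = (v f - z / r) / D"
  have "K \<noteq> {}" using \<open>N \<noteq> {f}\<close> f by (auto simp: K_def)
  then have k: "real (card K) > 0" and S: "S > 0"
    using v by (auto simp: S_def card_gt_0_iff intro!: sum_pos)
  have D: "D > 0" using k S v[of f] by (simp add: D_def add_pos_pos)
  have "v f - z / r > 0" using lt r by (simp add: field_simps)
  then have e: "e > 0" using D by (simp add: e_def)
  have "card K * (z / r) > 0" using k z r by simp
  then have "card K * (v f - z / r) < D"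
    using S unfolding D_def right_diff_distrib by linarith
  then have ke: "card K * e < 1" using D by (simp add: e_def)
  have De: "D * e = v f - z / r" using D by (simp add: e_def)
  define a where "a j = (if j = f then r * (1 - card K * e) else if j \<in> N then - (r * e) else 0)" for j
  have split: "(\<Sum>j\<in>UNIV. g j) = g f + (\<Sum>j\<in>K. g j)" if "\<And>j. j \<notin> N \<Longrightarrow> g j = 0" for g :: "'n \<Rightarrow> real"
  proof -
    have "(\<Sum>j\<in>UNIV. g j) = (\<Sum>j\<in>N. g j)" by (rule sum.mono_neutral_right) (use that in auto)
    also have "\<dots> = g f + (\<Sum>j\<in>K. g j)" using f by (simp add: K_def sum.remove)
    finally show ?thesis .
  qed
  have aK: "a j = - (r * e)" if "j \<in> K" for j using that by (auto simp: a_def K_def)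
  have "(\<Sum>j\<in>UNIV. \<bar>a j\<bar>) = \<bar>a f\<bar> + (\<Sum>j\<in>K. \<bar>a j\<bar>)"
    using f by (intro split) (auto simp: a_def)
  also have "(\<Sum>j\<in>K. \<bar>a j\<bar>) = card K * (r * e)" using r e by (simp add: aK)
  also have "\<bar>a f\<bar> = r * (1 - card K * e)" using r ke by (simp add: a_def)
  finally have 1: "(\<Sum>j\<in>UNIV. \<bar>a j\<bar>) = r" by (simp add: algebra_simps)
  have "(\<Sum>j\<in>UNIV. a j * v j) = a f * v f + (\<Sum>j\<in>K. a j * v j)"
    using f by (intro split) (auto simp: a_def)
  also have "(\<Sum>j\<in>K. a j * v j) = - (r * e) * S" by (simp add: aK S_def sum_distrib_left sum_negf)
  also have "a f * v f + - (r * e) * S = r * (v f - D * e)" by (simp add: a_def D_def algebra_simps)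
  also have "\<dots> = z" using r by (simp add: De)
  finally have 2: "(\<Sum>j\<in>UNIV. a j * v j) = z" .
  have 3: "a j \<noteq> 0 \<longleftrightarrow> j \<in> N" for j using f r e ke by (auto simp: a_def)
  show ?thesis using 1 2 3 by blast
qed

text \<open>\<open>row_weights\<close> fills the rows independently with real entries, giving the
  eigenvalue \<open>cmod s\<close> with eigenvector \<open>v\<close>. Multiplying by the phase
  \<open>sgn s\<close> keeps all moduli and turns the eigenvalue into \<open>s\<close>.\<close>

lemma spectrum_member:
  fixes B :: "real ^ 'n::finite ^ 'n"
  assumes r: "\<And>i. r i > 0" and B: "\<And>i j. B $ i $ j = (if (i, j) \<in> edges B then r i else 0)"
    and v: "\<And>i. v i > 0" and f: "\<And>i. (i, f i) \<in> edges B" and s: "s \<noteq> 0"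
    and cases: "\<And>i. (\<forall>j. (i, j) \<in> edges B \<longrightarrow> v j = v (f i)) \<and> cmod s * v i = r i * v (f i) \<or>
      (\<exists>j. (i, j) \<in> edges B \<and> j \<noteq> f i) \<and> cmod s * v i < r i * v (f i)"
  shows "s \<in> aux_spectrum B"
proof -
  have "\<exists>a. (\<forall>j. a j \<noteq> 0 \<longleftrightarrow> (i, j) \<in> edges B) \<and> (\<Sum>j\<in>UNIV. \<bar>a j\<bar>) = r i \<and>
    (\<Sum>j\<in>UNIV. a j * v j) = cmod s * v i" for i
    using row_weights[of "f i" "{j. (i, j) \<in> edges B}" v "r i" "cmod s * v i"] r[of i] v f[of i] s cases[of i]
    by auto
  then obtain a where a: "\<And>i j. a i j \<noteq> 0 \<longleftrightarrow> (i, j) \<in> edges B" "\<And>i. (\<Sum>j\<in>UNIV. \<bar>a i j\<bar>) = r i"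
    "\<And>i. (\<Sum>j\<in>UNIV. a i j * v j) = cmod s * v i"
    by metis
  define A :: "complex ^ 'n ^ 'n" where "A = (\<chi> i j. sgn s * of_real (a i j))"
  have sgn: "cmod (sgn s) = 1" using s by (simp only: norm_sgn if_False)
  then have "sgn s \<noteq> 0" by auto
  have sgn_mult: "sgn s * of_real (cmod s) = s" using s by (simp add: sgn_eq)
  have "Aux (moduli A) = B"
    unfolding Aux_moduli_iff[OF r B] using a sgn \<open>sgn s \<noteq> 0\<close> by (simp add: A_def norm_mult)
  moreover have "det (A - mat s) = 0"
    unfolding det_eigenvector
  proof (intro exI conjI allI)
    show "(\<chi> i. complex_of_real (v i)) \<noteq> 0" using v by (simp add: vec_eq_iff less_imp_neq[symmetric])
    fix i
    have "(\<Sum>j\<in>UNIV. A $ i $ j * (\<chi> i. complex_of_real (v i)) $ j) = sgn s * of_real (\<Sum>j\<in>UNIV. a i j * v j)"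
      by (simp add: A_def sum_distrib_left mult_ac)
    also have "\<dots> = s * (\<chi> i. complex_of_real (v i)) $ i"
      using sgn_mult by (simp add: a(3))
    finally show "(\<Sum>j\<in>UNIV. A $ i $ j * (\<chi> i. complex_of_real (v i)) $ j) = s * (\<chi> i. complex_of_real (v i)) $ i" .
  qed
  ultimately show ?thesis by (auto simp: aux_spectrum_def)
qed

text \<open>Let \<open>f\<close> step to a node closer to the root \<open>w\<close>, and let
  \<open>v i\<close> be the product of \<open>c\<close> along the branch from \<open>i\<close>,
  excluding \<open>w\<close>. The empty product gives \<open>v w = 1\<close>.\<close>

lemma tree_weights:
  fixes c :: "'a \<Rightarrow> real"
  assumes reach: "\<And>i. (i, w) \<in> E\<^sup>*" and c: "\<And>i. c i > 0"
  obtains f v where "\<And>i. v i > 0" "\<And>i. i \<noteq> w \<Longrightarrow> (i, f i) \<in> E \<and> v i = c i * v (f i)"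
proof -
  define d where "d i = (LEAST n. (i, w) \<in> E ^^ n)" for i
  have d: "(i, w) \<in> E ^^ d i" for i
    using reach[of i] unfolding d_def rtrancl_power by (rule LeastI_ex)
  have d_le: "d i \<le> n" if "(i, w) \<in> E ^^ n" for i n
    unfolding d_def using that by (rule Least_le)
  have "\<exists>j. (i, j) \<in> E \<and> d i = Suc (d j)" if "i \<noteq> w" for i
  proof (cases "d i")
    case 0
    then show ?thesis using d[of i] that by simp
  next
    case (Suc n)
    then obtain j where j: "(i, j) \<in> E" "(j, w) \<in> E ^^ n" using d[of i] by (metis relpow_Suc_D2)
    have "d i \<le> Suc (d j)" using d_le relpow_Suc_I2[OF j(1) d] by blast
    then show ?thesis using d_le[OF j(2)] Suc j(1) by (intro exI[of _ j]) auto
  qed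
  then obtain f where f: "\<And>i. i \<noteq> w \<Longrightarrow> (i, f i) \<in> E \<and> d i = Suc (d (f i))" by metis
  define v where "v i = (\<Prod>n<d i. c ((f ^^ n) i))" for i
  have "v i > 0" for i using c by (auto simp: v_def intro: prod_pos)
  moreover have "v i = c i * v (f i)" if "i \<noteq> w" for i
    using f[OF that] by (simp add: v_def prod.lessThan_Suc_shift funpow_swap1 del: prod.lessThan_Suc)
  ultimately show ?thesis using that f by blast
qed

text \<open>Rows with a single nonzero entry force \<open>cmod s * v i = r i * v (f i)\<close>; in all other rows the
  larger value \<open>t\<close> makes the inequality strict. Around the maximal cycle this
  leaves slack, which is absorbed by the branching node \<open>w\<close>.\<close>

lemma below_mu_in_spectrum:
  fixes B :: "real ^ 'n::finite ^ 'n"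
  assumes B: "nonneg_matrix B" and ru: "row_uniform B" and irr: "irreducible_matrix B"
    and multi: "\<not> unicyclic B" and s: "0 < cmod s" "cmod s < mu B"
  shows "s \<in> aux_spectrum B"
proof -
  obtain r where r: "\<And>i. r i > 0" and Br: "\<And>i j. B $ i $ j = (if (i, j) \<in> edges B then r i else 0)"
    using row_values[OF B ru] by blast
  obtain t where t: "cmod s < t" "t < mu B" using dense s by blast
  have "cycle_means B \<noteq> {}" using s by (auto simp: mu_def split: if_splits)
  then obtain q where "cycle_in B q" by (auto simp: cycle_means_def)
  then obtain p where p: "cycle_in B p" "cycle_mean B p = mu B" by (rule mu_attained)
  obtain w z u where w: "(w, z) \<in> set p" "(w, u) \<in> edges B" "u \<noteq> z"
    using multicyclic_branching[OF irr multi p(1)] by blast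
  have pE: "set p \<subseteq> edges B" using p by (simp add: cycle_in_iff)
  define V where "V = fst ` set p"
  \<comment> \<open>Cycle nodes keep only their cycle arc, so that the tree towards \<open>w\<close>
    follows the cycle.\<close>
  define E where "E = set p \<union> {(i, j) \<in> edges B. i \<notin> V}"
  have wV: "w \<in> V" using w by (force simp: V_def)
  have EV: "(i, w) \<in> E\<^sup>*" if "i \<in> V" for i
    using cycle_strongly_connected[OF p(1), of i w] that wV rtrancl_mono[of "set p" E]
    by (auto simp: V_def E_def)
  have reach: "(i, w) \<in> E\<^sup>*" for i
    using irreducible_rtrancl[OF irr, of i w]
  proof (induction rule: converse_rtrancl_induct)
    case (step i j)
    show ?case
    proof (cases "i \<in> V")
      case False
      then have "(i, j) \<in> E" using step by (auto simp: E_def)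
      then show ?thesis using step by (meson converse_rtrancl_into_rtrancl)
    qed (rule EV)
  qed auto
  define single where "single i \<longleftrightarrow> (\<forall>j k. (i, j) \<in> edges B \<longrightarrow> (i, k) \<in> edges B \<longrightarrow> k = j)" for i
  define \<tau> where "\<tau> i = (if single i then cmod s else t)" for i
  have "t > 0" using s(1) t(1) by (rule less_trans)
  then have \<tau>_pos: "\<tau> i > 0" for i using s(1) by (simp add: \<tau>_def)
  have \<tau>_le: "\<tau> i \<le> t" for i using t(1) by (simp add: \<tau>_def)
  have "r i / \<tau> i > 0" for i using r[of i] \<tau>_pos[of i] by simp
  then obtain f v where v: "\<And>i. v i > 0"
    and fv: "\<And>i. i \<noteq> w \<Longrightarrow> (i, f i) \<in> E \<and> v i = r i / \<tau> i * v (f i)"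
    using tree_weights[OF reach, of "\<lambda>i. r i / \<tau> i"] by metis
  \<comment> \<open>The root has no prescribed successor; sending it along its cycle arc makes all
    of \<open>p\<close> part of the functional graph.\<close>
  define g where "g = f(w := z)"
  have gE: "(i, g i) \<in> edges B" for i
    using fv[of i] w(1) pE by (auto simp: g_def E_def)
  have succ: "j = k" if "(i, j) \<in> set p" "(i, k) \<in> set p" for i j k
    using inj_onD[OF cycle_ends(1)[OF p(1)] _ that] by simp
  have gp: "g i = j" if "(i, j) \<in> set p" for i j
  proof (cases "i = w")
    case True
    then show ?thesis using succ that w(1) by (auto simp: g_def)
  next
    case False
    have "i \<in> V" using that by (force simp: V_def)
    then have "(i, f i) \<in> set p" using fv[OF False] by (auto simp: E_def)
    then show ?thesis using succ that False by (auto simp: g_def)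
  qed
  have gv: "\<tau> i * v i = r i * v (g i)" if "i \<noteq> w" for i
    using fv[OF that] \<tau>_pos[of i] that by (simp add: g_def)
  have not_single: "\<not> single w" using w pE by (auto simp: single_def)
  \<comment> \<open>Otherwise every arc of \<open>p\<close> would satisfy the bound with factor
    \<open>t\<close>, and the mean of \<open>p\<close> would be at most
    \<open>t < mu B\<close>.\<close>
  have slack: "cmod s * v w < r w * v z"
  proof (rule ccontr)
    assume "\<not> ?thesis"
    then have ge: "r w * v z \<le> t * v w" using t(1) v[of w] by (smt (verit) mult_right_mono)
    have "cycle_mean B p \<le> t"
    proof (rule cycle_mean_le[OF B p(1) v])
      show "t \<ge> 0" using \<open>t > 0\<close> by simp
      fix i j assume ij: "(i, j) \<in> set p"
      have "r i * v j \<le> t * v i"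
      proof (cases "i = w")
        case True
        then show ?thesis using ge gp[OF ij] by (simp add: g_def)
      next
        case False
        then have "r i * v j = \<tau> i * v i" using gv[OF False] gp[OF ij] by simp
        also have "\<dots> \<le> t * v i" using \<tau>_le[of i] v[of i] by simp
        finally show ?thesis .
      qed
      then show "B $ i $ j * v j \<le> t * v i" using Br[of i j] ij pE by auto
    qed
    then show False using p(2) t(2) by simp
  qed
  show ?thesis
  proof (rule spectrum_member[OF r Br v gE])
    show "s \<noteq> 0" using s by auto
    fix i
    show "(\<forall>j. (i, j) \<in> edges B \<longrightarrow> v j = v (g i)) \<and> cmod s * v i = r i * v (g i) \<or>
      (\<exists>j. (i, j) \<in> edges B \<and> j \<noteq> g i) \<and> cmod s * v i < r i * v (g i)"
    proof (cases "single i")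
      case True
      then have "i \<noteq> w" using not_single by auto
      then have "cmod s * v i = r i * v (g i)" using gv[of i] True by (simp add: \<tau>_def)
      moreover have "j = g i" if "(i, j) \<in> edges B" for j
        using True that gE[of i] by (auto simp: single_def)
      ultimately show ?thesis by auto
    next
      case False
      then have "\<exists>j. (i, j) \<in> edges B \<and> j \<noteq> g i" by (auto simp: single_def)
      moreover have "cmod s * v i < r i * v (g i)"
      proof (cases "i = w")
        case True
        then show ?thesis using slack by (simp add: g_def)
      next
        case False
        have "cmod s * v i < t * v i" using t(1) v[of i] by simp
        then show ?thesis using gv[OF False] \<open>\<not> single i\<close> by (simp add: \<tau>_def)
      qed
      ultimately show ?thesis by blast
    qed
  qed
qed

section \<open>The modulus \<open>mu B\<close> and the general bound\<close>

text \<open>Row uniformity and tightness make \<open>x\<close> constant on the successors of each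
  node, which is the equality case of \<open>spectrum_member\<close>.\<close>

lemma tight_in_spectrum:
  fixes B :: "real ^ 'n::finite ^ 'n"
  assumes B: "nonneg_matrix B" and ru: "row_uniform B" and irr: "irreducible_matrix B"
    and p: "cycle_in B p" and x: "\<And>i. x i > 0"
    and tight: "\<And>i j. (i, j) \<in> edges B \<Longrightarrow> B $ i $ j * x j = mu B * x i"
    and s: "cmod s = mu B"
  shows "s \<in> aux_spectrum B"
proof -
  obtain r where r: "\<And>i. r i > 0" and Br: "\<And>i j. B $ i $ j = (if (i, j) \<in> edges B then r i else 0)"
    using row_values[OF B ru] by blast
  have "mu B > 0" using cycle_mean_power(1)[OF B p] cycle_mean_le_mu[OF p] by simp
  \<comment> \<open>Every node has a successor: \<open>w\<close> as a cycle node, any other node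
    through its walk to \<open>w\<close>.\<close>
  obtain w where w: "w \<in> fst ` set p" "w \<in> Domain (edges B)"
    using p by (fastforce simp: cycle_in_iff neq_Nil_conv)
  have "\<exists>j. (i, j) \<in> edges B" for i
    using irreducible_rtrancl[OF irr, of i w] w(2) by (cases rule: converse_rtranclE) auto
  then obtain f where f: "\<And>i. (i, f i) \<in> edges B" by metis
  have rx: "r i * x j = mu B * x i" if "(i, j) \<in> edges B" for i j
    using tight[OF that] Br[of i j] that by simp
  have "x j = x (f i)" if "(i, j) \<in> edges B" for i j
    using rx[OF that] rx[OF f[of i]] r[of i] by (metis less_irrefl mult_left_cancel)
  moreover have "cmod s * x i = r i * x (f i)" for i using rx[OF f] s by simp
  moreover have "s \<noteq> 0" using s \<open>mu B > 0\<close> by auto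
  ultimately show ?thesis by (intro spectrum_member[where v = x, OF r Br x f]) auto
qed

text \<open>Potentials need a positive factor, but \<open>mu B\<close> is 0 for the 1 by 1 zero
  matrix; hence the detour through \<open>mu B + e\<close>.\<close>

lemma spectrum_le_mu:
  fixes B :: "real ^ 'n::finite ^ 'n"
  assumes B: "nonneg_matrix B" and ru: "row_uniform B" and irr: "irreducible_matrix B"
    and s: "s \<in> aux_spectrum B"
  shows "cmod s \<le> mu B"
proof (rule field_le_epsilon)
  fix e :: real assume e: "e > 0"
  have "mu B \<ge> 0"
  proof (cases "cycle_means B = {}")
    case False
    then obtain p where "cycle_in B p" by (auto simp: cycle_means_def)
    then show ?thesis using cycle_mean_power(1)[OF B] cycle_mean_le_mu by (meson less_imp_le order_trans)
  qed (simp add: mu_def)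
  then have m: "mu B + e > 0" using e by simp
  have "cycle_mean B p \<le> mu B + e" if "cycle_in B p" for p
    using cycle_mean_le_mu[OF that] e by simp
  then obtain x where "\<And>i. x i > 0" "\<And>i j. B $ i $ j * x j \<le> (mu B + e) * x i"
    using potential_exists[OF B m] by blast
  then show "cmod s \<le> mu B + e" using spectrum_upper(1)[OF B ru irr s m] by blast
qed

lemma mu_potential:
  fixes B :: "real ^ 'n::finite ^ 'n"
  assumes "nonneg_matrix B" "mu B > 0"
  obtains x where "\<And>i. x i > 0" "\<And>i j. B $ i $ j * x j \<le> mu B * x i"
  using potential_exists[OF assms] cycle_mean_le_mu by metis

section \<open>The three cases\<close>

text \<open>All arcs lie on one cycle of mean \<open>mu B\<close>, so a potential is tight
  everywhere. Conversely, each row of \<open>A\<close> has one nonzero entry, so the moduli of an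
  eigenvector satisfy the tight equations with factor \<open>cmod s\<close>, which must then be the
  cycle mean.\<close>

lemma unicyclic_spectrum:
  fixes B :: "real ^ 'n::finite ^ 'n"
  assumes B: "nonneg_matrix B" and ru: "row_uniform B" and irr: "irreducible_matrix B"
    and uni: "unicyclic B"
  shows "aux_spectrum B = {s. cmod s = mu B}"
proof -
  obtain q where "cycle_in B q" using uni by (auto simp: unicyclic_def)
  then obtain p where p: "cycle_in B p" "cycle_mean B p = mu B" by (rule mu_attained)
  have "set p \<subseteq> edges B" using p(1) by (simp add: cycle_in_iff)
  then have "k = j" if "(i, j) \<in> set p" "(i, k) \<in> edges B" for i j k
    using unicyclic_unique_out[OF uni _ that(2)] that(1) by (meson subsetD)
  then have pE: "set p = edges B"
    by (rule cycle_without_branching(2)[OF irr p(1)])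
  have mu: "mu B > 0" using cycle_mean_power(1)[OF B p(1)] p(2) by simp
  obtain x where x: "\<And>i. x i > 0" "\<And>i j. B $ i $ j * x j \<le> mu B * x i"
    using mu_potential[OF B mu] by blast
  have "B $ i $ j * x j = mu B * x i" if "(i, j) \<in> edges B" for i j
    using cycle_tight[where v = x, OF B p(1) x(1), of i j] x(2) that unfolding p(2) pE by blast
  then have "s \<in> aux_spectrum B" if "cmod s = mu B" for s
    using tight_in_spectrum[where x = x, OF B ru irr p(1) x(1)] that by blast
  moreover have "cmod s = mu B" if s: "s \<in> aux_spectrum B" for s
  proof -
    obtain r where r: "\<And>i. r i > 0" and Br: "\<And>i j. B $ i $ j = (if (i, j) \<in> edges B then r i else 0)"
      using row_values[OF B ru] by blast
    obtain A where A: "Aux (moduli A) = B" and det: "det (A - mat s) = 0"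
      using s by (auto simp: aux_spectrum_def)
    note AB = iffD1[OF Aux_moduli_iff[OF r Br] A]
    have A0: "A $ i $ j \<noteq> 0 \<longleftrightarrow> (i, j) \<in> edges B" for i j using AB by blast
    obtain v where v: "v \<noteq> 0" and Av: "\<And>i. (\<Sum>j\<in>UNIV. A $ i $ j * v $ j) = s * v $ i"
      using det unfolding det_eigenvector by blast
    \<comment> \<open>Polymorphic, as it is applied to real moduli and to complex products.\<close>
    have row: "(\<Sum>k\<in>UNIV. g k) = g j" if e: "(i, j) \<in> edges B" and g: "\<And>k. A $ i $ k = 0 \<Longrightarrow> g k = 0"
      for i j and g :: "'n \<Rightarrow> 'b::comm_monoid_add"
    proof -
      have "(\<Sum>k\<in>UNIV. g k) = (\<Sum>k\<in>{j}. g k)"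
      proof (rule sum.mono_neutral_right)
        show "\<forall>k\<in>UNIV - {j}. g k = 0"
        proof
          fix k assume "k \<in> UNIV - {j}"
          then have "(i, k) \<notin> edges B" using unicyclic_unique_out[OF uni e, of k] by auto
          then show "g k = 0" using A0 g by blast
        qed
      qed auto
      then show ?thesis by simp
    qed
    have Aij: "cmod (A $ i $ j) = r i" if "(i, j) \<in> edges B" for i j
    proof -
      have "(\<Sum>k\<in>UNIV. cmod (A $ i $ k)) = r i" using AB that by blast
      moreover have "(\<Sum>k\<in>UNIV. cmod (A $ i $ k)) = cmod (A $ i $ j)" by (rule row[OF that]) simp
      ultimately show ?thesis by simp
    qed
    have eq: "B $ i $ j * cmod (v $ j) = cmod s * cmod (v $ i)" if "(i, j) \<in> edges B" for i j
    proof -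
      have "A $ i $ j * v $ j = s * v $ i"
        using Av[of i] row[OF that, of "\<lambda>k. A $ i $ k * v $ k"] by simp
      then have "cmod (A $ i $ j) * cmod (v $ j) = cmod s * cmod (v $ i)" by (metis norm_mult)
      then show ?thesis using Aij[OF that] Br[of i j] that by simp
    qed
    \<comment> \<open>By \<open>eq\<close>, a zero of \<open>v\<close> spreads along arcs to all
      nodes.\<close>
    have v0: "v $ i \<noteq> 0" for i
    proof
      assume i: "v $ i = 0"
      have "v $ k = 0" if "v $ j = 0" "(j, k) \<in> edges B" for j k
        using eq[OF that(2)] that r[of j] Br[of j k] by auto
      then have "{i. v $ i = 0} = UNIV"
        using i by (intro irreducible_closed_UNIV[OF irr, of i]) auto
      then show False using v by (auto simp: vec_eq_iff)
    qed
    have "cycle_mean B p = cmod s"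
      by (rule cycle_mean_eq[OF B p(1), of "\<lambda>i. cmod (v $ i)"]) (simp_all add: v0 eq pE)
    then show ?thesis using p(2) by simp
  qed
  ultimately show ?thesis by blast
qed

theorem theorem4p4:
  fixes B :: "real ^ 'n::finite ^ 'n"
  assumes "nonneg_matrix B" and "row_uniform B" and "irreducible_matrix B"
  shows "(unicyclic B \<longrightarrow> aux_spectrum B = {s. cmod s = mu B}) \<and>
    (multicyclic B \<and> nu B < mu B \<longrightarrow> aux_spectrum B - {0} = {s. 0 < cmod s \<and> cmod s < mu B}) \<and>
    (multicyclic B \<and> nu B = mu B \<longrightarrow> aux_spectrum B - {0} = {s. 0 < cmod s \<and> cmod s \<le> mu B})"
proof (intro conjI impI)
  note le = spectrum_le_mu[OF assms] and below = below_mu_in_spectrum[OF assms]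
  show "aux_spectrum B = {s. cmod s = mu B}" if "unicyclic B"
    using unicyclic_spectrum[OF assms that] .
  show "aux_spectrum B - {0} = {s. 0 < cmod s \<and> cmod s < mu B}" if "multicyclic B \<and> nu B < mu B"
  proof -
    have "cycle_means B \<noteq> {}" using that by (auto simp: mu_def nu_def)
    then obtain q where "cycle_in B q" by (auto simp: cycle_means_def)
    \<comment> \<open>If \<open>cmod s = mu B\<close>, all arcs are tight, so even this cycle of
      minimal mean would have mean \<open>mu B\<close>.\<close>
    then obtain p where p: "cycle_in B p" "cycle_mean B p = nu B" by (rule nu_attained)
    then have mu: "mu B > 0" using cycle_mean_power(1)[OF assms(1) p(1)] that by simp
    obtain x where x: "\<And>i. x i > 0" "\<And>i j. B $ i $ j * x j \<le> mu B * x i"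
      using mu_potential[OF assms(1) mu] by blast
    have "cmod s \<noteq> mu B" if s: "s \<in> aux_spectrum B" for s
    proof
      assume sm: "cmod s = mu B"
      have "cycle_mean B p = mu B"
      proof (rule cycle_mean_eq[where v = x, OF assms(1) p(1) x(1)])
        show "B $ i $ j * x j = mu B * x i" if "(i, j) \<in> set p" for i j
          using spectrum_upper(2)[OF assms s mu x sm] that p(1) by (auto simp: cycle_in_iff)
      qed (use mu in simp)
      then show False using p(2) \<open>multicyclic B \<and> nu B < mu B\<close> by simp
    qed
    then have "cmod s < mu B" if "s \<in> aux_spectrum B" for s using le[OF that] that by (simp add: less_le)
    moreover have "s \<in> aux_spectrum B" if "0 < cmod s" "cmod s < mu B" for s
      using below that \<open>multicyclic B \<and> nu B < mu B\<close> by (simp add: multicyclic_def)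
    ultimately show ?thesis by auto
  qed
  show "aux_spectrum B - {0} = {s. 0 < cmod s \<and> cmod s \<le> mu B}" if multi: "multicyclic B \<and> nu B = mu B"
  proof -
    have "s \<in> aux_spectrum B" if s: "0 < cmod s" "cmod s = mu B" for s
    proof -
      have "cycle_means B \<noteq> {}" using s by (auto simp: mu_def split: if_splits)
      then obtain p where p: "cycle_in B p" by (auto simp: cycle_means_def)
      have mu: "mu B > 0" using s by simp
      obtain x where x: "\<And>i. x i > 0" "\<And>i j. B $ i $ j * x j \<le> mu B * x i"
        using mu_potential[OF assms(1) mu] by blast
      have "B $ i $ j * x j = mu B * x i" if ij: "(i, j) \<in> edges B" for i j
      proof -
        \<comment> \<open>Every arc lies on some cycle, whose mean is squeezed between
          \<open>nu B\<close> and \<open>mu B\<close>; hence every arc is tight.\<close>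
        obtain q where q: "cycle_in B q" "(i, j) \<in> set q"
          using edge_on_cycle[OF assms(3) ij] by blast
        then have "cycle_mean B q = mu B"
          using cycle_mean_le_mu[OF q(1)] nu_le_cycle_mean[OF q(1)] multi by simp
        then show ?thesis using cycle_tight[where v = x, OF assms(1) q(1) x(1) _ q(2)] x(2) by simp
      qed
      then show ?thesis using tight_in_spectrum[where x = x, OF assms p x(1)] s(2) by blast
    qed
    moreover have "s \<in> aux_spectrum B" if "0 < cmod s" "cmod s < mu B" for s
      using below that multi by (simp add: multicyclic_def)
    ultimately have "s \<in> aux_spectrum B" if "0 < cmod s" "cmod s \<le> mu B" for s
      using that by (cases "cmod s = mu B") auto
    then show ?thesis using le by auto
  qed
qed

end
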